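(* Let $\Theta\subseteq\mathbb{R}^m$ be nonempty, convex and compact, contained in a ball of radius $R$, let $\mathcal{A}=\mathbb{R}^n$, and let $f:\Theta\times\mathcal{A}\to\mathbb{R}$ be continuously differentiable. Assume there are constants $L_{11},L_{22},L_{12}$ such that for all $\theta,\theta_1,\theta_2\in\Theta$ and $\alpha,\alpha_1,\alpha_2\in\mathcal{A}$: $\|\nabla_\theta f(\theta_1,\alpha)-\nabla_\theta f(\theta_2,\alpha)\|\le L_{11}\|\theta_1-\theta_2\|$, $\|\nabla_\alpha f(\theta,\alpha_1)-\nabla_\alpha f(\theta,\alpha_2)\|\le L_{22}\|\alpha_1-\alpha_2\|$, $\|\nabla_\alpha f(\theta_1,\alpha)-\nabla_\alpha f(\theta_2,\alpha)\|\le L_{12}\|\theta_1-\theta_2\|$, $\|\nabla_\theta f(\theta,\alpha_1)-\nabla_\theta f(\theta,\alpha_2)\|\le L_{12}\|\alpha_1-\alpha_2\|$. Assume also that there is $\mu>0$ such that for every $\theta\in\Theta$ the function $\alpha\mapsto -f(\theta,\alpha)$ is $\mu$-PL. Then, for every $\varepsilon\in(0,1)$, multi-step gradient descent ascent (with suitable numbers $T$ of outer and $K$ of inner iterations) finds an $\varepsilon$-first-order Nash equilibrium of $\min_{\theta\in\Theta}\max_{\alpha\in\mathcal{A}}f(\theta,\alpha)$, that is, at least one of the computed pairs $(\theta_t,\alpha_K(\theta_t))$ is an $\varepsilon$-first-order Nash equilibrium, using $\mathcal{O}(\varepsilon^{-2})$ evaluations of $\nabla_\theta f$ and $\mathcal{O}(\varepsilon^{-2}\log(\varepsilon^{-1}))$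 evaluations of $\nabla_\alpha f$ as $\varepsilon\to0$ (hidden constants depend on the problem data and starting points but not on $\varepsilon$). If the two gradient oracles have the same cost, the overall complexity is $\mathcal{O}(\varepsilon^{-2}\log(\varepsilon^{-1}))$.
   Context: A differentiable function $h$ with minimum value $h^*=\min_x h(x)$ (assumed attained) is $\mu$-PL if $\frac12\|\nabla h(x)\|^2\ge\mu(h(x)-h^* )$ for all $x$. $\varepsilon$-first-order Nash equilibrium ($\varepsilon$-FNE): a point $(\theta^*,\alpha^* )\in\Theta\times\mathcal{A}$ with $\mathcal{X}(\theta^*,\alpha^* )\le\varepsilon$ and $\mathcal{Y}(\theta^*,\alpha^* )\le\varepsilon$, where $\mathcal{X}(\theta^*,\alpha^* )=-\min\{\langle\nabla_\theta f(\theta^*,\alpha^* ),\theta-\theta^*\rangle:\theta\in\Theta,\ \|\theta-\theta^*\|\le1\}$ and $\mathcal{Y}(\theta^*,\alpha^* )=\max\{\langle\nabla_\alpha f(\theta^*,\alpha^* ),\alpha-\alpha^*\rangle:\alpha\in\mathcal{A},\ \|\alpha-\alpha^*\|\le1\}$. Let $g(\theta)=\max_{\alpha\in\mathcal{A}}f(\theta,\alpha)$, and let $L>0$ be a Lipschitz smoothness constant of $g$, i.e. $\|\nabla g(\theta_1)-\nabla g(\theta_2)\|\le L\|\theta_1-\theta_2\|$ for all $\theta_1,\theta_2\in\Theta$. Multi-step gradient descent ascent, from given $\theta_0\in\Theta$, $\alpha_0\in\mathcal{A}$, with $T$ outer and $K$ inner iterations, $\eta_1=1/L_{22}$, $\eta_2=1/L$: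 for $t=0,\dots,T-1$ set $\alpha_0(\theta_t)=\alpha_t$; for $k=0,\dots,K-1$ set $\alpha_{k+1}(\theta_t)=\alpha_k(\theta_t)+\eta_1\nabla_\alpha f(\theta_t,\alpha_k(\theta_t))$; set $\alpha_{t+1}=\alpha_K(\theta_t)$ and $\theta_{t+1}=\mathrm{proj}_\Theta\big(\theta_t-\eta_2\nabla_\theta f(\theta_t,\alpha_K(\theta_t))\big)$, where $\mathrm{proj}_\Theta$ is Euclidean projection onto $\Theta$. It returns the pairs $(\theta_t,\alpha_K(\theta_t))$, $t=0,\dots,T-1$. Each outer iteration uses one evaluation of $\nabla_\theta f$ and $K$ evaluations of $\nabla_\alpha f$. *)

theory Defs
  imports "HOL-Analysis.Analysis" "HOL-Library.Landau_Symbols"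
begin

definition gradient :: "('a::real_inner \<Rightarrow> real) \<Rightarrow> 'a \<Rightarrow> 'a" where
  "gradient h x = (THE D. GDERIV h x :> D)"

definition PL :: "real \<Rightarrow> ('a::euclidean_space \<Rightarrow> real) \<Rightarrow> bool" where
  "PL \<mu> h \<longleftrightarrow>
     (\<forall>x. h differentiable (at x)) \<and>
     (\<exists>x0. \<forall>x. h x0 \<le> h x) \<and>
     (\<forall>x. 1 / 2 * (norm (gradient h x))\<^sup>2 \<ge> \<mu> * (h x - (INF y. h y)))"

text \<open>
  Gradients on a set that need not be open, such as \<open>\<Theta>\<close> or \<open>\<Theta> \<times> UNIV\<close>, are vector fields
  representing the derivative within that set. If \<open>\<Theta>\<close> has empty interior, such a field is
  unique only up to directions normal to \<open>\<Theta>\<close>; therefore the partial gradients of \<open>f\<close> are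
  parameters, so that every choice (for example the one coming from a smooth extension of \<open>f\<close>
  to a neighbourhood of the set) is covered. Convex sets with nonempty interior leave no choice.
\<close>

definition gradient_field_on :: "('a::real_inner \<Rightarrow> real) \<Rightarrow> ('a \<Rightarrow> 'a) \<Rightarrow> 'a set \<Rightarrow> bool" where
  "gradient_field_on h G S \<longleftrightarrow> (\<forall>x\<in>S. (h has_derivative (\<lambda>u. G x \<bullet> u)) (at x within S))"

definition C1_with_partial_gradients_on ::
  "('a::euclidean_space \<Rightarrow> 'b::euclidean_space \<Rightarrow> real) \<Rightarrow> ('a \<Rightarrow> 'b \<Rightarrow> 'a) \<Rightarrow> ('a \<Rightarrow> 'b \<Rightarrow> 'b)
     \<Rightarrow> ('a \<times> 'b) set \<Rightarrow> bool" where
  "C1_with_partial_gradients_on f f\<theta> f\<alpha> S \<longleftrightarrow>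
     gradient_field_on (\<lambda>(\<theta>, \<alpha>). f \<theta> \<alpha>) (\<lambda>(\<theta>, \<alpha>). (f\<theta> \<theta> \<alpha>, f\<alpha> \<theta> \<alpha>)) S \<and>
     continuous_on S (\<lambda>(\<theta>, \<alpha>). f\<theta> \<theta> \<alpha>) \<and>
     continuous_on S (\<lambda>(\<theta>, \<alpha>). f\<alpha> \<theta> \<alpha>)"

definition smoothness_constant_on :: "real \<Rightarrow> ('a::real_inner \<Rightarrow> real) \<Rightarrow> 'a set \<Rightarrow> bool" where
  "smoothness_constant_on L h S \<longleftrightarrow>
     (\<exists>G. gradient_field_on h G S \<and>
          (\<forall>x\<in>S. \<forall>y\<in>S. norm (G x - G y) \<le> L * norm (x - y)))"

text \<open>
  The suprema and infima below are attained in the intended use: in \<open>max_value\<close> by the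
  attainment clause of \<open>PL\<close>, in the two stationarity gaps by compactness of the feasible sets.
\<close>

definition max_value :: "('a \<Rightarrow> 'b \<Rightarrow> real) \<Rightarrow> 'b set \<Rightarrow> 'a \<Rightarrow> real" where
  "max_value f A \<theta> = (SUP \<alpha>\<in>A. f \<theta> \<alpha>)"

definition gap_min :: "('a::real_inner \<Rightarrow> 'b \<Rightarrow> 'a) \<Rightarrow> 'a set \<Rightarrow> 'a \<Rightarrow> 'b \<Rightarrow> real" where
  "gap_min f\<theta> \<Theta> \<theta>' \<alpha>' = - (INF \<theta>\<in>{\<theta>\<in>\<Theta>. norm (\<theta> - \<theta>') \<le> 1}. f\<theta> \<theta>' \<alpha>' \<bullet> (\<theta> - \<theta>'))"

definition gap_max :: "('a \<Rightarrow> 'b::real_inner \<Rightarrow> 'b) \<Rightarrow> 'b set \<Rightarrow> 'a \<Rightarrow> 'b \<Rightarrow> real" where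
  "gap_max f\<alpha> A \<theta>' \<alpha>' = (SUP \<alpha>\<in>{\<alpha>\<in>A. norm (\<alpha> - \<alpha>') \<le> 1}. f\<alpha> \<theta>' \<alpha>' \<bullet> (\<alpha> - \<alpha>'))"

definition first_order_Nash ::
  "('a::real_inner \<Rightarrow> 'b::real_inner \<Rightarrow> 'a) \<Rightarrow> ('a \<Rightarrow> 'b \<Rightarrow> 'b) \<Rightarrow> 'a set \<Rightarrow> 'b set
     \<Rightarrow> real \<Rightarrow> 'a \<times> 'b \<Rightarrow> bool" where
  "first_order_Nash f\<theta> f\<alpha> \<Theta> A \<epsilon> = (\<lambda>(\<theta>', \<alpha>').
     \<theta>' \<in> \<Theta> \<and> \<alpha>' \<in> A \<and> gap_min f\<theta> \<Theta> \<theta>' \<alpha>' \<le> \<epsilon> \<and> gap_max f\<alpha> A \<theta>' \<alpha>' \<le> \<epsilon>)"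

text \<open>
  \<open>ascent f\<alpha> \<eta>\<^sub>1 \<theta> \<alpha> k\<close> is the inner iterate \<open>\<alpha>\<^sub>k(\<theta>)\<close> started at \<open>\<alpha>\<close>;
  \<open>gda f\<theta> f\<alpha> \<Theta> \<eta>\<^sub>1 \<eta>\<^sub>2 K \<theta>\<^sub>0 \<alpha>\<^sub>0 t\<close> is \<open>(\<theta>\<^sub>t, \<alpha>\<^sub>t)\<close>. The iterates do not depend on the number
  \<open>T\<close> of outer iterations, which only says how many of them are computed and returned.
\<close>

primrec ascent :: "('a \<Rightarrow> 'b::real_vector \<Rightarrow> 'b) \<Rightarrow> real \<Rightarrow> 'a \<Rightarrow> 'b \<Rightarrow> nat \<Rightarrow> 'b" where
  "ascent f\<alpha> \<eta>\<^sub>1 \<theta> \<alpha> 0 = \<alpha>"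
| "ascent f\<alpha> \<eta>\<^sub>1 \<theta> \<alpha> (Suc k) =
     ascent f\<alpha> \<eta>\<^sub>1 \<theta> \<alpha> k + \<eta>\<^sub>1 *\<^sub>R f\<alpha> \<theta> (ascent f\<alpha> \<eta>\<^sub>1 \<theta> \<alpha> k)"

primrec gda ::
  "('a::euclidean_space \<Rightarrow> 'b::euclidean_space \<Rightarrow> 'a) \<Rightarrow> ('a \<Rightarrow> 'b \<Rightarrow> 'b) \<Rightarrow> 'a set
     \<Rightarrow> real \<Rightarrow> real \<Rightarrow> nat \<Rightarrow> 'a \<Rightarrow> 'b \<Rightarrow> nat \<Rightarrow> 'a \<times> 'b" where
  "gda f\<theta> f\<alpha> \<Theta> \<eta>\<^sub>1 \<eta>\<^sub>2 K \<theta>\<^sub>0 \<alpha>\<^sub>0 0 = (\<theta>\<^sub>0, \<alpha>\<^sub>0)"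
| "gda f\<theta> f\<alpha> \<Theta> \<eta>\<^sub>1 \<eta>\<^sub>2 K \<theta>\<^sub>0 \<alpha>\<^sub>0 (Suc t) =
     (let (\<theta>, \<alpha>) = gda f\<theta> f\<alpha> \<Theta> \<eta>\<^sub>1 \<eta>\<^sub>2 K \<theta>\<^sub>0 \<alpha>\<^sub>0 t;
          \<alpha>' = ascent f\<alpha> \<eta>\<^sub>1 \<theta> \<alpha> K
      in (closest_point \<Theta> (\<theta> - \<eta>\<^sub>2 *\<^sub>R f\<theta> \<theta> \<alpha>'), \<alpha>'))"

definition gda_returned ::
  "('a::euclidean_space \<Rightarrow> 'b::euclidean_space \<Rightarrow> 'a) \<Rightarrow> ('a \<Rightarrow> 'b \<Rightarrow> 'b) \<Rightarrow> 'a set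
     \<Rightarrow> real \<Rightarrow> real \<Rightarrow> nat \<Rightarrow> nat \<Rightarrow> 'a \<Rightarrow> 'b \<Rightarrow> ('a \<times> 'b) list" where
  "gda_returned f\<theta> f\<alpha> \<Theta> \<eta>\<^sub>1 \<eta>\<^sub>2 T K \<theta>\<^sub>0 \<alpha>\<^sub>0 =
     map (\<lambda>t. let (\<theta>, \<alpha>) = gda f\<theta> f\<alpha> \<Theta> \<eta>\<^sub>1 \<eta>\<^sub>2 K \<theta>\<^sub>0 \<alpha>\<^sub>0 t in (\<theta>, ascent f\<alpha> \<eta>\<^sub>1 \<theta> \<alpha> K)) [0..<T]"

text \<open>
  Oracle counts: an outer iteration calls \<open>f\<theta>\<close> once and an inner iteration calls \<open>f\<alpha>\<close> once.
\<close>

definition theta_grad_evals :: "nat \<Rightarrow> nat" where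
  "theta_grad_evals T = (\<Sum>t<T. 1)"

definition alpha_grad_evals :: "nat \<Rightarrow> nat \<Rightarrow> nat" where
  "alpha_grad_evals T K = (\<Sum>t<T. \<Sum>k<K. 1)"

end

theory Submission imports Defs begin

text \<open>
  Under the PL condition gradient ascent converges linearly, and the distance of any point to the
  set of maximizers is at most a constant times the norm of its gradient. The maximizers therefore
  vary Lipschitz-continuously with \<open>\<theta>\<close>, so that \<open>g\<close> has derivative \<open>f\<theta> \<theta> \<alpha>*\<close> within \<open>\<Theta>\<close> for every
  maximizer \<open>\<alpha>*\<close>, and an inner loop ending with gradient of size \<open>O(\<epsilon>)\<close> provides a gradient of \<open>g\<close>
  with error \<open>O(\<epsilon>)\<close>. Since the warm start of the next inner loop has a uniformly bounded gap, \<open>O(log(1/\<epsilon>))\<close>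
  inner steps always suffice. The outer loop is then inexact projected gradient descent on \<open>g\<close>: each
  step of length above a multiple of \<open>\<epsilon>\<close> decreases \<open>g\<close> by a multiple of \<open>\<epsilon>\<^sup>2\<close>, and a shorter step
  certifies stationarity. The gap is estimated through the gradient field of \<open>g\<close>, which is bounded
  on \<open>\<Theta>\<close>, and not through \<open>f\<theta>\<close>, which may be unbounded along the \<open>\<alpha>\<close>-iterates in directions normal
  to \<open>\<Theta>\<close>.
\<close>

section \<open>Derivatives along segments of a convex set\<close>

lemma convex_segment_mem:
  fixes x :: "'a::real_vector"
  assumes "convex S" "x \<in> S" "y \<in> S" "0 \<le> s" "s \<le> 1"
  shows "x + s *\<^sub>R (y - x) \<in> S"
proof -
  have "(1 - s) *\<^sub>R x + s *\<^sub>R y \<in> S" using assms by (intro convexD) auto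
  then show ?thesis by (simp add: algebra_simps)
qed

lemma has_derivative_along_segment:
  fixes h :: "'a::real_inner \<Rightarrow> real"
  assumes "convex S" "x \<in> S" "y \<in> S"
    and "(h has_derivative (\<lambda>u. p \<bullet> u)) (at (x + s *\<^sub>R (y - x)) within S)"
  shows "((\<lambda>s. h (x + s *\<^sub>R (y - x))) has_derivative (\<lambda>r. r * (p \<bullet> (y - x)))) (at s within {0..1})"
proof -
  have "((\<lambda>s. x + s *\<^sub>R (y - x)) has_derivative (\<lambda>r. r *\<^sub>R (y - x))) (at s within {0..1})"
    by (auto intro!: derivative_eq_intros)
  moreover have "(\<lambda>s. x + s *\<^sub>R (y - x)) ` {0..1} \<subseteq> S"
    using convex_segment_mem[OF assms(1-3)] by auto
  ultimately show ?thesis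
    using has_derivative_in_compose[of "\<lambda>s. x + s *\<^sub>R (y - x)" "\<lambda>r. r *\<^sub>R (y - x)" s "{0..1}" h "\<lambda>u. p \<bullet> u"]
      has_derivative_subset[OF assms(4)] by simp
qed

text \<open>Restricted to the segment from \<open>x\<close> to \<open>y\<close>, a derivative within
  \<open>S\<close> becomes a one-sided derivative in one real variable, which is unique. So two
  representing vectors agree in feasible directions, even where they differ in directions normal to
  \<open>S\<close>.\<close>

lemma feasible_derivative_unique:
  fixes h :: "'a::real_inner \<Rightarrow> real"
  assumes "convex S" "x \<in> S" "y \<in> S"
    and D: "(h has_derivative (\<lambda>u. p \<bullet> u)) (at x within S)" "(h has_derivative (\<lambda>u. q \<bullet> u)) (at x within S)"
  shows "p \<bullet> (y - x) = q \<bullet> (y - x)"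
proof -
  have "((\<lambda>s. h (x + s *\<^sub>R (y - x))) has_vector_derivative (p \<bullet> (y - x))) (at 0 within cbox 0 1)"
    if "(h has_derivative (\<lambda>u. p \<bullet> u)) (at x within S)" for p
    using has_derivative_along_segment[OF assms(1-3), of h p 0] that
    by (simp add: has_vector_derivative_def)
  from vector_derivative_unique_within_closed_interval[OF _ _ this[OF D(1)] this[OF D(2)]]
  show ?thesis by simp
qed

text \<open>The mean value theorem is applied along the segment to \<open>h\<close> minus its linear
  and quadratic terms; Cauchy-Schwarz and the Lipschitz bound make the derivative of this difference
  nonpositive. Only points of \<open>S\<close> are visited, so derivatives within \<open>S\<close>
  suffice.\<close>

lemma descent_lemma:
  fixes h :: "'a::real_inner \<Rightarrow> real"
  assumes "convex S" "gradient_field_on h G S" "x \<in> S" "y \<in> S"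
    and lip: "\<And>x y. x \<in> S \<Longrightarrow> y \<in> S \<Longrightarrow> norm (G x - G y) \<le> L * norm (x - y)"
  shows "h y \<le> h x + G x \<bullet> (y - x) + L / 2 * (norm (y - x))\<^sup>2"
proof -
  define d where "d = y - x"
  let ?\<phi> = "\<lambda>s. h (x + s *\<^sub>R d) - s * (G x \<bullet> d) - L / 2 * s\<^sup>2 * (norm d)\<^sup>2"
  let ?\<phi>' = "\<lambda>s. G (x + s *\<^sub>R d) \<bullet> d - G x \<bullet> d - L * s * (norm d)\<^sup>2"
  have "(?\<phi> has_derivative (\<lambda>r. r * ?\<phi>' s)) (at s within {0..1})" if "0 \<le> s" "s \<le> 1" for s
    using has_derivative_along_segment[OF assms(1,3,4), of h "G (x + s *\<^sub>R (y - x))" s] assms(2)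
      convex_segment_mem[OF assms(1,3,4) that] unfolding d_def gradient_field_on_def
    by (auto intro!: derivative_eq_intros simp: algebra_simps)
  from mvt_simple[OF zero_less_one this]
  obtain s where s: "s \<in> {0<..<1}" "?\<phi> 1 - ?\<phi> 0 = ?\<phi>' s" by auto
  have mem: "x + s *\<^sub>R d \<in> S"
    using convex_segment_mem[OF assms(1,3,4), of s] s by (simp add: d_def)
  have "(G (x + s *\<^sub>R d) - G x) \<bullet> d \<le> norm (G (x + s *\<^sub>R d) - G x) * norm d"
    by (rule norm_cauchy_schwarz)
  also have "\<dots> \<le> (L * norm (s *\<^sub>R d)) * norm d"
    using lip[OF mem assms(3)] by (intro mult_right_mono) auto
  also have "\<dots> = L * s * (norm d)\<^sup>2"
    using s by (simp add: power2_eq_square)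
  finally have "?\<phi>' s \<le> 0" by (simp add: inner_diff_left)
  then show ?thesis using s by (simp add: d_def)
qed

section \<open>Gradient ascent for smooth functions and under the PL condition\<close>

lemma gradient_field_on_minus:
  "gradient_field_on h G S \<Longrightarrow> gradient_field_on (\<lambda>x. - h x) (\<lambda>x. - G x) S"
  by (simp add: gradient_field_on_def has_derivative_minus)

text \<open>With step \<open>1 / L\<close> the linear gain is
  \<open>(norm (F x))\<^sup>2 / L\<close>, and the quadratic term of the descent lemma for
  \<open>- \<phi>\<close> costs half of it.\<close>

lemma ascent_step:
  fixes \<phi> :: "'a::real_inner \<Rightarrow> real"
  assumes "gradient_field_on \<phi> F UNIV" "L > 0"
    and "\<And>x y. norm (F x - F y) \<le> L * norm (x - y)"
  shows "\<phi> x + (norm (F x))\<^sup>2 / (2 * L) \<le> \<phi> (x + (1 / L) *\<^sub>R F x)"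
proof -
  have "- \<phi> (x + (1 / L) *\<^sub>R F x) \<le> - \<phi> x + (- F x) \<bullet> ((1 / L) *\<^sub>R F x) + L / 2 * (norm ((1 / L) *\<^sub>R F x))\<^sup>2"
    using descent_lemma[OF convex_UNIV gradient_field_on_minus[OF assms(1)], of x "x + (1 / L) *\<^sub>R F x" L]
    by (simp add: assms(3) norm_minus_commute)
  also have "\<dots> = - \<phi> x - (norm (F x))\<^sup>2 / (2 * L)"
    using assms(2) by (simp add: power2_norm_eq_inner[symmetric] power_divide field_simps power2_eq_square)
  finally show ?thesis by simp
qed

text \<open>The gain of one ascent step cannot exceed the remaining gap
  \<open>M - \<phi> x\<close>.\<close>

lemma gradient_norm_bound:
  fixes \<phi> :: "'a::real_inner \<Rightarrow> real"
  assumes "gradient_field_on \<phi> F UNIV" "L \<ge> 0"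
    and lip: "\<And>x y. norm (F x - F y) \<le> L * norm (x - y)"
    and "\<And>x. \<phi> x \<le> M"
  shows "(norm (F x))\<^sup>2 \<le> 2 * L * (M - \<phi> x)"
proof -
  \<comment> \<open>\<open>L = 0\<close> is allowed and leaves no usable step \<open>1 / L\<close>,
    so the bound is proved for every \<open>L' > L\<close>, and \<open>L'\<close> then tends to
    \<open>L\<close> from the right.\<close>
  have *: "(norm (F x))\<^sup>2 \<le> 2 * (M - \<phi> x) * L'" if "L' > L" for L'
  proof -
    have "norm (F x - F y) \<le> L' * norm (x - y)" for x y
      using lip[of x y] that mult_right_mono[of L L' "norm (x - y)"] by auto
    from ascent_step[OF assms(1) _ this, of x] assms(2) that
    have "\<phi> x + (norm (F x))\<^sup>2 / (2 * L') \<le> \<phi> (x + (1 / L') *\<^sub>R F x)" by auto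
    also have "\<dots> \<le> M" by (rule assms(4))
    finally show ?thesis using assms(2) that by (simp add: field_simps)
  qed
  have "((\<lambda>L'. 2 * (M - \<phi> x) * L') \<longlongrightarrow> 2 * (M - \<phi> x) * L) (at_right L)"
    by (intro tendsto_intros)
  then have "(norm (F x))\<^sup>2 \<le> 2 * (M - \<phi> x) * L"
    by (rule tendsto_lowerbound) (use * in \<open>simp_all add: eventually_at_filter\<close>)
  then show ?thesis by (simp add: algebra_simps)
qed

text \<open>The PL inequality turns the gain of one step into at least the fraction
  \<open>\<mu> / L\<close> of the current gap. The bound \<open>\<mu> \<le> L\<close> keeps the
  contraction factor nonnegative, so that the induction hypothesis can be multiplied by it.\<close>

lemma ascent_geometric:
  fixes x :: "'a::real_inner"
  assumes "gradient_field_on \<phi> (F s) UNIV" "L > 0" "\<mu> \<le> L"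
    and "\<And>x y. norm (F s x - F s y) \<le> L * norm (x - y)"
    and pl: "\<And>x. \<mu> * (M - \<phi> x) \<le> 1 / 2 * (norm (F s x))\<^sup>2"
  shows "M - \<phi> (ascent F (1 / L) s x k) \<le> (1 - \<mu> / L) ^ k * (M - \<phi> x)"
proof (induction k)
  case (Suc k)
  define z where "z = ascent F (1 / L) s x k"
  have "M - \<phi> (ascent F (1 / L) s x (Suc k)) \<le> M - \<phi> z - (norm (F s z))\<^sup>2 / (2 * L)"
    using ascent_step[of \<phi> "F s" L z] assms(1,2,4) by (simp add: z_def)
  also have "\<dots> \<le> M - \<phi> z - \<mu> * (M - \<phi> z) / L"
    using divide_right_mono[OF pl[of z], of L] assms(2) by simp
  also have "\<dots> = (1 - \<mu> / L) * (M - \<phi> z)"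
    by (simp add: left_diff_distrib)
  also have "\<dots> \<le> (1 - \<mu> / L) * ((1 - \<mu> / L) ^ k * (M - \<phi> x))"
    using Suc assms(2,3) by (intro mult_left_mono) (auto simp: z_def)
  finally show ?case by simp
qed simp

text \<open>The iterates of gradient ascent have geometrically decaying steps, so their limit is a
  maximizer whose distance to the starting point is controlled by the initial gradient.\<close>

lemma PL_error_bound:
  fixes x :: "'a::{real_inner, banach}"
  assumes grad: "gradient_field_on \<phi> F UNIV" and "L > 0" "0 < \<mu>" "\<mu> < L"
    and lip: "\<And>x y. norm (F x - F y) \<le> L * norm (x - y)"
    and pl: "\<And>x. \<mu> * (M - \<phi> x) \<le> 1 / 2 * (norm (F x))\<^sup>2"
    and max: "\<And>x. \<phi> x \<le> M"
  shows "\<exists>x'. \<phi> x' = M \<and> norm (x' - x) \<le> norm (F x) / (sqrt (\<mu> * L) * (1 - sqrt (1 - \<mu> / L)))"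
proof -
  define \<rho> where "\<rho> = 1 - \<mu> / L"
  define \<delta> where "\<delta> = M - \<phi> x"
  \<comment> \<open>\<open>ascent\<close> expects a parameter; the one-point type supplies a
    dummy.\<close>
  define z where "z = ascent (\<lambda>_::unit. F) (1 / L) () x"
  \<comment> \<open>\<open>c\<close> is chosen so that \<open>L * (c * sqrt \<rho> ^ k)\<close>
    equals \<open>sqrt (2 * L * (\<rho> ^ k * \<delta>))\<close>, the gradient bound at the iterate
    \<open>z k\<close>.\<close>
  define c where "c = sqrt (2 * \<delta> / L)"
  have \<rho>: "0 < \<rho>" "\<rho> < 1" using assms by (auto simp: \<rho>_def)
  have \<delta>: "\<delta> \<ge> 0" using max by (simp add: \<delta>_def)
  have gap: "M - \<phi> (z k) \<le> \<rho> ^ k * \<delta>" for k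
    using ascent_geometric[of \<phi> "\<lambda>_. F" "()" L \<mu> M x k] assms by (simp add: z_def \<rho>_def \<delta>_def)
  have step: "norm ((1 / L) *\<^sub>R F (z k)) \<le> c * sqrt \<rho> ^ k" for k
  proof -
    have "(norm (F (z k)))\<^sup>2 \<le> 2 * L * (M - \<phi> (z k))"
      using gradient_norm_bound[OF grad _ lip max] assms(2) by simp
    also have "\<dots> \<le> 2 * L * (\<rho> ^ k * \<delta>)"
      using gap assms(2) by (intro mult_left_mono) auto
    finally have "norm (F (z k)) \<le> sqrt (2 * L * (\<rho> ^ k * \<delta>))"
      by (rule real_le_rsqrt)
    also have "\<dots> = L * (c * sqrt \<rho> ^ k)"
    proof -
      have "2 * L * (\<rho> ^ k * \<delta>) = (L * (c * sqrt \<rho> ^ k))\<^sup>2"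
        using assms(2) \<delta> \<rho>
        by (simp add: c_def power_mult_distrib power_mult[symmetric] mult.commute[of k] power2_eq_square[of L])
           (simp add: power_mult)
      then show ?thesis using assms(2) \<delta> \<rho> by (simp add: c_def)
    qed
    finally show ?thesis using assms(2) by (simp add: field_simps)
  qed
  have r: "norm (sqrt \<rho>) < 1" using \<rho> by simp
  have sumg: "(\<lambda>k. c * sqrt \<rho> ^ k) sums (c * (1 / (1 - sqrt \<rho>)))"
    using sums_mult[OF geometric_sums[OF r]] .
  have sn: "summable (\<lambda>k. norm ((1 / L) *\<^sub>R F (z k)))"
    by (rule summable_norm_comparison_test[OF _ sums_summable[OF sumg]]) (use step in blast)
  define v where "v = (\<Sum>k. (1 / L) *\<^sub>R F (z k))"
  \<comment> \<open>The iterates are \<open>x\<close> plus partial sums of an absolutely summable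
    series, so completeness yields the limit \<open>x + v\<close>.\<close>
  have zk: "z k = x + (\<Sum>i<k. (1 / L) *\<^sub>R F (z i))" for k
    by (induction k) (auto simp: z_def)
  have "(\<lambda>k. \<Sum>i<k. (1 / L) *\<^sub>R F (z i)) \<longlonglongrightarrow> v"
    unfolding v_def using summable_norm_cancel[OF sn] by (rule summable_LIMSEQ)
  then have "(\<lambda>k. x + (\<Sum>i<k. (1 / L) *\<^sub>R F (z i))) \<longlonglongrightarrow> x + v"
    by (intro tendsto_intros)
  then have lim: "z \<longlonglongrightarrow> x + v" by (simp add: zk[symmetric])
  \<comment> \<open>Continuity carries the vanishing gap over to the limit, which is therefore a
    maximizer.\<close>
  have "isCont \<phi> (x + v)"
    using grad by (auto simp: gradient_field_on_def intro: has_derivative_continuous)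
  then have "(\<lambda>k. M - \<phi> (z k)) \<longlonglongrightarrow> M - \<phi> (x + v)"
    by (intro tendsto_intros isCont_tendsto_compose[OF _ lim])
  moreover have "(\<lambda>k. \<rho> ^ k * \<delta>) \<longlonglongrightarrow> 0 * \<delta>"
    using \<rho> by (intro tendsto_intros LIMSEQ_power_zero) auto
  ultimately have "M - \<phi> (x + v) \<le> 0 * \<delta>"
    by (rule LIMSEQ_le) (use gap in auto)
  then have "\<phi> (x + v) = M" using max[of "x + v"] by simp
  moreover have "norm v \<le> norm (F x) / (sqrt (\<mu> * L) * (1 - sqrt \<rho>))"
  proof -
    have "norm v \<le> (\<Sum>k. norm ((1 / L) *\<^sub>R F (z k)))"
      unfolding v_def by (rule summable_norm[OF sn])
    also have "\<dots> \<le> (\<Sum>k. c * sqrt \<rho> ^ k)"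
      by (rule suminf_le[OF step sn sums_summable[OF sumg]])
    also have "\<dots> = c / (1 - sqrt \<rho>)" using sums_unique[OF sumg] by simp
    also have "\<dots> \<le> (norm (F x) / sqrt (\<mu> * L)) / (1 - sqrt \<rho>)"
    proof (rule divide_right_mono)
      \<comment> \<open>PL at the starting point bounds the initial gap \<open>\<delta>\<close> by
        the squared initial gradient, which turns \<open>c\<close> into a multiple of
        \<open>norm (F x)\<close>.\<close>
      have "2 * \<delta> / L \<le> (norm (F x))\<^sup>2 / (\<mu> * L)"
        using divide_right_mono[OF pl[of x], of "\<mu> * L / 2"] assms(2,3) by (simp add: \<delta>_def mult.commute)
      then have "c \<le> sqrt ((norm (F x))\<^sup>2 / (\<mu> * L))" by (simp add: c_def)
      then show "c \<le> norm (F x) / sqrt (\<mu> * L)" by (simp add: real_sqrt_divide)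
    qed (use r \<rho> in auto)
    finally show ?thesis by simp
  qed
  ultimately show ?thesis by (intro exI[of _ "x + v"]) (simp add: \<rho>_def)
qed

text \<open>Since \<open>\<mu>\<close> may be decreased, \<open>\<mu> \<le> L / 2\<close> can be enforced; for \<open>L = 0\<close> the functions are
  constant and the step size \<open>1 / L\<close> is irrelevant.\<close>

lemma PL_ascent_constants:
  fixes \<phi> :: "'i \<Rightarrow> 'a::{real_inner, banach} \<Rightarrow> real"
  assumes "L \<ge> 0" "\<mu> > 0"
    and grad: "\<And>s. s \<in> S \<Longrightarrow> gradient_field_on (\<phi> s) (F s) UNIV"
    and lip: "\<And>s x y. s \<in> S \<Longrightarrow> norm (F s x - F s y) \<le> L * norm (x - y)"
    and pl: "\<And>s x. s \<in> S \<Longrightarrow> \<mu> * (M s - \<phi> s x) \<le> 1 / 2 * (norm (F s x))\<^sup>2"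
    and max: "\<And>s x. s \<in> S \<Longrightarrow> \<phi> s x \<le> M s"
  obtains \<rho> C where "0 < \<rho>" "\<rho> < 1" "C > 0"
    "\<And>s x k. s \<in> S \<Longrightarrow> M s - \<phi> s (ascent F (1 / L) s x k) \<le> \<rho> ^ k * (M s - \<phi> s x)"
    "\<And>s x. s \<in> S \<Longrightarrow> \<exists>x'. \<phi> s x' = M s \<and> norm (x' - x) \<le> C * norm (F s x)"
proof (cases "L = 0")
  case True
  have "\<phi> s x = M s" if "s \<in> S" for s x
  proof -
    have "F s x = 0"
      using gradient_norm_bound[OF grad[OF that] assms(1) lip[OF that] max[OF that], of x] True by simp
    then have "M s - \<phi> s x \<le> 0"
      using pl[OF that, of x] assms(2) by (simp add: mult_le_0_iff)
    then show ?thesis using max[OF that, of x] by simp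
  qed
  then have "\<exists>x'. \<phi> s x' = M s \<and> norm (x' - x) \<le> 1 * norm (F s x)" if "s \<in> S" for s x
    using that by (intro exI[of _ x]) simp
  then show ?thesis
    using \<open>\<And>x s. s \<in> S \<Longrightarrow> \<phi> s x = M s\<close> by (intro that[of "1 / 2" 1]) auto
next
  case False
  define m where "m = min \<mu> (L / 2)"
  have m: "0 < m" "m < L" "m \<le> \<mu>" "L > 0" using assms(1,2) False by (auto simp: m_def)
  \<comment> \<open>The gap is nonnegative by \<open>max\<close>, so the inequality survives
    lowering \<open>\<mu>\<close> to \<open>m\<close>.\<close>
  have pl': "m * (M s - \<phi> s x) \<le> 1 / 2 * (norm (F s x))\<^sup>2" if "s \<in> S" for s x
    using mult_right_mono[OF m(3), of "M s - \<phi> s x"] pl[OF that, of x] max[OF that, of x] by simp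
  have b: "M s - \<phi> s (ascent F (1 / L) s x k) \<le> (1 - m / L) ^ k * (M s - \<phi> s x)" if "s \<in> S" for s x k
    using ascent_geometric[of "\<phi> s" F s L m "M s"] grad[OF that] lip[OF that] pl'[OF that] m by simp
  have "sqrt (1 - m / L) < 1" using m by simp
  then show ?thesis
    using m PL_error_bound[OF grad m(4,1,2) lip pl' max]
    by (intro that[of "1 - m / L" "1 / (sqrt (m * L) * (1 - sqrt (1 - m / L)))"] b) auto
qed

section \<open>Differentiability of the value function\<close>

text \<open>Danskin's theorem without concavity: it suffices that the maximizers vary Lipschitz-continuously.\<close>

lemma has_derivative_max_value:
  fixes f :: "'a::real_inner \<Rightarrow> 'b::real_inner \<Rightarrow> real"
  assumes D: "((\<lambda>(\<theta>, \<alpha>). f \<theta> \<alpha>) has_derivative (\<lambda>u. (p, 0) \<bullet> u)) (at (\<theta>, \<alpha>) within \<Theta> \<times> UNIV)"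
    and "f \<theta> \<alpha> = g \<theta>" "C \<ge> 0"
    and sel: "\<And>\<theta>'. \<theta>' \<in> \<Theta> \<Longrightarrow> \<exists>\<alpha>'. f \<theta>' \<alpha>' = g \<theta>' \<and> norm (\<alpha>' - \<alpha>) \<le> C * norm (\<theta>' - \<theta>)"
  shows "(g has_derivative (\<lambda>u. p \<bullet> u)) (at \<theta> within \<Theta>)"
  unfolding has_derivative_within_alt
proof (intro conjI allI impI)
  show "bounded_linear ((\<bullet>) p)" by (rule bounded_linear_inner_right)
  fix e :: real assume "e > 0"
  \<comment> \<open>Moving to \<open>\<theta>'\<close> together with its maximizer displaces the
    pair by at most \<open>(1 + C) * norm (\<theta>' - \<theta>)\<close>; the division compensates
    for this factor.\<close>
  define e' where "e' = e / (1 + C)"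
  have e': "e' > 0" using \<open>e > 0\<close> assms(3) by (simp add: e'_def)
  then obtain d where d: "d > 0" and dd: "\<And>y. y \<in> \<Theta> \<times> UNIV \<Longrightarrow> norm (y - (\<theta>, \<alpha>)) < d \<Longrightarrow>
    norm ((\<lambda>(\<theta>, \<alpha>). f \<theta> \<alpha>) y - f \<theta> \<alpha> - (p, 0) \<bullet> (y - (\<theta>, \<alpha>))) \<le> e' * norm (y - (\<theta>, \<alpha>))"
    using D unfolding has_derivative_within_alt by fastforce
  have "norm (g \<theta>' - g \<theta> - p \<bullet> (\<theta>' - \<theta>)) \<le> e * norm (\<theta>' - \<theta>)"
    if \<theta>': "\<theta>' \<in> \<Theta>" "norm (\<theta>' - \<theta>) < d / (1 + C)" for \<theta>'
  proof -
    obtain \<alpha>' where \<alpha>': "f \<theta>' \<alpha>' = g \<theta>'" "norm (\<alpha>' - \<alpha>) \<le> C * norm (\<theta>' - \<theta>)"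
      using sel[OF \<theta>'(1)] by auto
    have n: "norm ((\<theta>', \<alpha>') - (\<theta>, \<alpha>)) \<le> (1 + C) * norm (\<theta>' - \<theta>)"
      using norm_Pair_le[of "\<theta>' - \<theta>" "\<alpha>' - \<alpha>"] \<alpha>'(2) by (simp add: algebra_simps)
    also have "\<dots> < d" using \<theta>' assms(3) by (simp add: field_simps)
    finally have "norm (g \<theta>' - g \<theta> - p \<bullet> (\<theta>' - \<theta>)) \<le> e' * norm ((\<theta>', \<alpha>') - (\<theta>, \<alpha>))"
      using dd[of "(\<theta>', \<alpha>')"] \<theta>' \<alpha>'(1) assms(2) by simp
    also have "\<dots> \<le> e' * ((1 + C) * norm (\<theta>' - \<theta>))" using n e' by (intro mult_left_mono) auto
    also have "\<dots> = e * norm (\<theta>' - \<theta>)" using assms(3) by (simp add: e'_def)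
    finally show ?thesis .
  qed
  then show "\<exists>d>0. \<forall>y\<in>\<Theta>. norm (y - \<theta>) < d \<longrightarrow> norm (g y - g \<theta> - p \<bullet> (y - \<theta>)) \<le> e * norm (y - \<theta>)"
    using d assms(3) by (intro exI[of _ "d / (1 + C)"]) auto
qed

section \<open>Inexact projected gradient descent\<close>

text \<open>The variational inequality of the projection yields descent when tested at
  \<open>\<theta>\<close>, and bounds the stationarity gap by the step length when tested at
  \<open>u\<close>. The error of \<open>q\<close> is measured in feasible directions only, since
  \<open>q\<close> and \<open>G \<theta>\<close> may differ widely in normal ones.\<close>

lemma inexact_projected_gradient_step:
  fixes g :: "'a::euclidean_space \<Rightarrow> real"
  assumes "convex \<Theta>" "closed \<Theta>" "\<theta> \<in> \<Theta>" "L > 0"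
    and grad: "gradient_field_on g G \<Theta>"
    and lip: "\<And>x y. x \<in> \<Theta> \<Longrightarrow> y \<in> \<Theta> \<Longrightarrow> norm (G x - G y) \<le> L * norm (x - y)"
    and err: "\<And>u. u \<in> \<Theta> \<Longrightarrow> \<bar>(q - G \<theta>) \<bullet> (u - \<theta>)\<bar> \<le> e * norm (u - \<theta>)"
  defines "\<theta>' \<equiv> closest_point \<Theta> (\<theta> - (1 / L) *\<^sub>R q)"
  shows "g \<theta>' \<le> g \<theta> - L / 4 * (norm (\<theta>' - \<theta>))\<^sup>2 + e\<^sup>2 / L"
    and "\<And>u. u \<in> \<Theta> \<Longrightarrow> norm (u - \<theta>) \<le> 1 \<Longrightarrow>
           - (norm (G \<theta>) + e + L) * norm (\<theta>' - \<theta>) \<le> q \<bullet> (u - \<theta>)"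
proof -
  define d where "d = \<theta>' - \<theta>"
  have \<theta>': "\<theta>' \<in> \<Theta>"
    unfolding \<theta>'_def using assms(2,3) by (intro closest_point_in_set) auto
  have err_d: "\<bar>(q - G \<theta>) \<bullet> d\<bar> \<le> e * norm d" using err[OF \<theta>'] by (simp add: d_def)
  have vi: "0 \<le> q \<bullet> (u - \<theta>') + L * (d \<bullet> (u - \<theta>'))" if "u \<in> \<Theta>" for u
  proof -
    have "(\<theta> - (1 / L) *\<^sub>R q - \<theta>') \<bullet> (u - \<theta>') \<le> 0"
      unfolding \<theta>'_def by (rule closest_point_dot[OF assms(1,2) that])
    then have "0 \<le> (1 / L) * (q \<bullet> (u - \<theta>')) + d \<bullet> (u - \<theta>')"
      by (simp add: d_def inner_diff_left inner_diff_right algebra_simps)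
    then have "0 \<le> L * ((1 / L) * (q \<bullet> (u - \<theta>')) + d \<bullet> (u - \<theta>'))"
      using assms(4) by simp
    then show ?thesis using assms(4) by (simp add: distrib_left)
  qed
  have qd: "q \<bullet> d \<le> - L * (norm d)\<^sup>2"
    using vi[OF assms(3)] by (simp add: d_def power2_norm_eq_inner inner_diff_left inner_diff_right algebra_simps)
  have "g \<theta>' \<le> g \<theta> + G \<theta> \<bullet> d + L / 2 * (norm d)\<^sup>2"
    unfolding d_def by (rule descent_lemma[OF assms(1) grad assms(3) \<theta>' lip])
  also have "G \<theta> \<bullet> d \<le> - L * (norm d)\<^sup>2 + e * norm d"
    using qd err_d by (simp add: inner_diff_left)
  \<comment> \<open>Young's inequality with weights that leave \<open>L / 4\<close> of the available
    decrease \<open>L / 2\<close>.\<close>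
  also have "e * norm d \<le> L / 4 * (norm d)\<^sup>2 + e\<^sup>2 / L"
  proof -
    have "0 \<le> (L / 2 * norm d - e)\<^sup>2 / L" using assms(4) by simp
    also have "\<dots> = L / 4 * (norm d)\<^sup>2 + e\<^sup>2 / L - e * norm d"
      using assms(4) by (simp add: power2_eq_square field_simps)
    finally show ?thesis by simp
  qed
  finally show "g \<theta>' \<le> g \<theta> - L / 4 * (norm (\<theta>' - \<theta>))\<^sup>2 + e\<^sup>2 / L"
    by (simp add: d_def)
  fix u assume u: "u \<in> \<Theta>" "norm (u - \<theta>) \<le> 1"
  have "0 \<le> q \<bullet> (u - \<theta>') + L * (d \<bullet> (u - \<theta>'))" by (rule vi[OF u(1)])
  also have "\<dots> = q \<bullet> (u - \<theta>) - q \<bullet> d + L * (d \<bullet> (u - \<theta>)) - L * (norm d)\<^sup>2"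
    by (simp add: d_def power2_norm_eq_inner inner_diff_left inner_diff_right algebra_simps)
  finally have 1: "0 \<le> q \<bullet> (u - \<theta>) - q \<bullet> d + L * (d \<bullet> (u - \<theta>))"
    using mult_nonneg_nonneg[OF less_imp_le[OF assms(4)] zero_le_power2[of "norm d"]] by linarith
  \<comment> \<open>Passing from \<open>q\<close> to \<open>G \<theta>\<close> along the feasible
    direction \<open>d\<close> keeps \<open>norm q\<close> out of the bound.\<close>
  have 2: "- (q \<bullet> d) \<le> e * norm d + norm (G \<theta>) * norm d"
    using err_d Cauchy_Schwarz_ineq2[of "G \<theta>" d] by (simp add: inner_diff_left)
  have 3: "d \<bullet> (u - \<theta>) \<le> norm d"
  proof -
    have "d \<bullet> (u - \<theta>) \<le> norm d * norm (u - \<theta>)" by (rule norm_cauchy_schwarz)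
    also have "\<dots> \<le> norm d" using u(2) by (intro mult_right_le_one_le) auto
    finally show ?thesis .
  qed
  show "- (norm (G \<theta>) + e + L) * norm (\<theta>' - \<theta>) \<le> q \<bullet> (u - \<theta>)"
    using 1 2 mult_left_mono[OF 3 less_imp_le[OF assms(4)]]
    unfolding d_def[symmetric] by (simp only: minus_add_distrib distrib_right mult_minus_left)
qed

text \<open>If all \<open>T\<close> steps were longer than \<open>r\<close>, each would lower
  \<open>v\<close> by at least \<open>a * r\<^sup>2 - b\<close>, and \<open>v T\<close> would fall
  below \<open>lo\<close>.\<close>

lemma exists_small_step:
  fixes x :: "nat \<Rightarrow> 'a::real_normed_vector"
  assumes "a \<ge> 0"
    and "\<And>t. v (Suc t) \<le> v t - a * (norm (x (Suc t) - x t))\<^sup>2 + b"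
    and "\<And>t. lo \<le> v t" "r \<ge> 0" "v 0 - lo < real T * (a * r\<^sup>2 - b)"
  shows "\<exists>t<T. norm (x (Suc t) - x t) \<le> r"
proof (rule ccontr)
  assume "\<not> ?thesis"
  then have big: "r < norm (x (Suc t) - x t)" if "t < T" for t using that by force
  have "v t \<le> v 0 - real t * (a * r\<^sup>2 - b)" if "t \<le> T" for t
    using that
  proof (induction t)
    case (Suc t)
    have "r\<^sup>2 \<le> (norm (x (Suc t) - x t))\<^sup>2"
      using big[of t] Suc.prems assms(4) by (intro power_mono) auto
    then have "a * r\<^sup>2 \<le> a * (norm (x (Suc t) - x t))\<^sup>2" using assms(1) by (rule mult_left_mono)
    then show ?case using Suc assms(2)[of t] by (simp add: algebra_simps)
  qed simp
  from this[of T] assms(3)[of T] assms(5) show False by simp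
qed

section \<open>Equilibrium and PL conditions expressed by gradient fields\<close>

lemma first_order_NashI:
  assumes "\<theta> \<in> \<Theta>" "norm (f\<alpha> \<theta> \<alpha>) \<le> \<epsilon>"
    and "\<And>u. u \<in> \<Theta> \<Longrightarrow> norm (u - \<theta>) \<le> 1 \<Longrightarrow> - \<epsilon> \<le> f\<theta> \<theta> \<alpha> \<bullet> (u - \<theta>)"
  shows "first_order_Nash f\<theta> f\<alpha> \<Theta> UNIV \<epsilon> (\<theta>, \<alpha>)"
proof -
  have "f\<alpha> \<theta> \<alpha> \<bullet> (\<beta> - \<alpha>) \<le> \<epsilon>" if "norm (\<beta> - \<alpha>) \<le> 1" for \<beta>
  proof -
    have "f\<alpha> \<theta> \<alpha> \<bullet> (\<beta> - \<alpha>) \<le> norm (f\<alpha> \<theta> \<alpha>) * norm (\<beta> - \<alpha>)" by (rule norm_cauchy_schwarz)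
    also have "\<dots> \<le> norm (f\<alpha> \<theta> \<alpha>)" using that by (intro mult_right_le_one_le) auto
    finally show ?thesis using assms(2) by simp
  qed
  moreover have "\<exists>\<beta>. norm (\<beta> - \<alpha>) \<le> 1" by (rule exI[of _ \<alpha>]) simp
  ultimately have "gap_max f\<alpha> UNIV \<theta> \<alpha> \<le> \<epsilon>"
    unfolding gap_max_def by (intro cSUP_least) auto
  moreover have "- \<epsilon> \<le> (INF u\<in>{u\<in>\<Theta>. norm (u - \<theta>) \<le> 1}. f\<theta> \<theta> \<alpha> \<bullet> (u - \<theta>))"
    using assms(1,3) by (intro cINF_greatest) (auto intro!: exI[of _ \<theta>])
  ultimately show ?thesis
    using assms(1) by (simp add: first_order_Nash_def gap_min_def)
qed

text \<open>Attainment turns both the supremum of \<open>f \<theta>\<close> and the infimum of its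
  negative into values at one point \<open>a\<close>, and uniqueness of the derivative identifies
  the gradient in \<open>PL\<close> with \<open>- F\<close>.\<close>

lemma PL_minus_max_valueD:
  assumes PL: "PL \<mu> (\<lambda>\<alpha>. - f \<theta> \<alpha>)" and grad: "gradient_field_on (f \<theta>) F UNIV"
  shows "f \<theta> \<alpha> \<le> max_value f UNIV \<theta>"
    and "\<mu> * (max_value f UNIV \<theta> - f \<theta> \<alpha>) \<le> 1 / 2 * (norm (F \<alpha>))\<^sup>2"
proof -
  obtain a where a: "\<And>\<alpha>. f \<theta> \<alpha> \<le> f \<theta> a" using PL by (auto simp: PL_def)
  have g: "max_value f UNIV \<theta> = f \<theta> a"
    unfolding max_value_def using a by (intro cSup_eq_maximum) auto
  show "f \<theta> \<alpha> \<le> max_value f UNIV \<theta>" using a g by simp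
  have "(INF y. - f \<theta> y) = - f \<theta> a" using a by (intro cInf_eq_minimum) auto
  moreover have "gradient (\<lambda>\<alpha>. - f \<theta> \<alpha>) \<alpha> = - F \<alpha>"
    unfolding gradient_def
  proof (rule the_equality)
    have D: "((f \<theta>) has_derivative (\<lambda>u. F \<alpha> \<bullet> u)) (at \<alpha>)"
      using grad by (simp add: gradient_field_on_def)
    then have D': "GDERIV (\<lambda>\<alpha>. - f \<theta> \<alpha>) \<alpha> :> - F \<alpha>"
      using has_derivative_minus[OF D] by (simp add: gderiv_def inner_commute)
    then show "GDERIV (\<lambda>\<alpha>. - f \<theta> \<alpha>) \<alpha> :> - F \<alpha>" .
    show "D = - F \<alpha>" if "GDERIV (\<lambda>\<alpha>. - f \<theta> \<alpha>) \<alpha> :> D" for D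
    proof -
      have "(\<lambda>h. h \<bullet> D) = (\<lambda>h. h \<bullet> - F \<alpha>)"
        using has_derivative_unique that D' unfolding gderiv_def by blast
      then have "\<forall>h. h \<bullet> D = h \<bullet> - F \<alpha>" by (rule fun_cong[THEN allI])
      then show ?thesis by (rule vector_eq_ldot[THEN iffD1])
    qed
  qed
  moreover have "\<mu> * (- f \<theta> \<alpha> - (INF y. - f \<theta> y)) \<le> 1 / 2 * (norm (gradient (\<lambda>\<alpha>. - f \<theta> \<alpha>) \<alpha>))\<^sup>2"
    by (rule PL[unfolded PL_def, THEN conjunct2, THEN conjunct2, THEN spec])
  ultimately show "\<mu> * (max_value f UNIV \<theta> - f \<theta> \<alpha>) \<le> 1 / 2 * (norm (F \<alpha>))\<^sup>2"
    by (simp add: g)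
qed

section \<open>Iteration counts and their asymptotics\<close>

lemma geometric_iterations_suffice:
  fixes \<rho> A \<eta> :: real
  assumes "0 < \<rho>" "\<rho> < 1" "A > 0" "\<eta> > 0" "ln (A / \<eta>) / ln (1 / \<rho>) \<le> real K"
  shows "\<rho> ^ K * A \<le> \<eta>"
proof -
  have "ln (1 / \<rho>) > 0" using assms by simp
  then have "ln (A / \<eta>) \<le> real K * ln (1 / \<rho>)" using assms(5) by (simp add: pos_divide_le_eq)
  also have "\<dots> = ln ((1 / \<rho>) ^ K)" using assms(1) by (simp add: ln_realpow)
  finally have "A / \<eta> \<le> (1 / \<rho>) ^ K" using assms by simp
  then show ?thesis using assms by (simp add: field_simps)
qed

lemma oracle_complexity:
  fixes T K :: "real \<Rightarrow> nat"
  assumes "a \<ge> 0" "b \<ge> 0" "c \<ge> 0"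
    and T: "\<And>\<epsilon>. 0 < \<epsilon> \<Longrightarrow> \<epsilon> < 1 \<Longrightarrow> real (T \<epsilon>) \<le> a / \<epsilon>\<^sup>2"
    and K: "\<And>\<epsilon>. 0 < \<epsilon> \<Longrightarrow> \<epsilon> < 1 \<Longrightarrow> real (K \<epsilon>) \<le> b + c * ln (1 / \<epsilon>)"
  shows "(\<lambda>\<epsilon>. real (theta_grad_evals (T \<epsilon>))) \<in> O[at_right 0](\<lambda>\<epsilon>. 1 / \<epsilon>\<^sup>2)"
    and "(\<lambda>\<epsilon>. real (alpha_grad_evals (T \<epsilon>) (K \<epsilon>))) \<in> O[at_right 0](\<lambda>\<epsilon>. 1 / \<epsilon>\<^sup>2 * ln (1 / \<epsilon>))"
    and "(\<lambda>\<epsilon>. cost * real (theta_grad_evals (T \<epsilon>)) + cost * real (alpha_grad_evals (T \<epsilon>) (K \<epsilon>)))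
        \<in> O[at_right 0](\<lambda>\<epsilon>. 1 / \<epsilon>\<^sup>2 * ln (1 / \<epsilon>))"
proof -
  \<comment> \<open>Below \<open>exp (- 1)\<close> the logarithm \<open>ln (1 / \<epsilon>)\<close>
    is at least 1, so it absorbs the additive constant \<open>b\<close> and the count of outer
    gradients.\<close>
  have ev: "\<forall>\<^sub>F \<epsilon> in at_right 0. \<epsilon> \<in> {0<..<exp (- 1 :: real)}"
    by (rule eventually_at_right_real) simp
  have small: "0 < \<epsilon> \<and> \<epsilon> < 1 \<and> 1 \<le> ln (1 / \<epsilon>)" if "\<epsilon> \<in> {0<..<exp (- 1 :: real)}" for \<epsilon>
  proof -
    have "ln \<epsilon> < -1" using that ln_less_cancel_iff[of \<epsilon> "exp (- 1)"] by simp
    moreover have "exp (- 1 :: real) < 1" by simp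
    ultimately show ?thesis using that by (auto simp: ln_div simp del: exp_less_one_iff)
  qed
  show 1: "(\<lambda>\<epsilon>. real (theta_grad_evals (T \<epsilon>))) \<in> O[at_right 0](\<lambda>\<epsilon>. 1 / \<epsilon>\<^sup>2)"
  proof (rule bigoI[of _ a])
    show "\<forall>\<^sub>F \<epsilon> in at_right 0. norm (real (theta_grad_evals (T \<epsilon>))) \<le> a * norm (1 / \<epsilon>\<^sup>2)"
      using ev by eventually_elim (use T small in \<open>simp add: theta_grad_evals_def\<close>)
  qed
  show 2: "(\<lambda>\<epsilon>. real (alpha_grad_evals (T \<epsilon>) (K \<epsilon>))) \<in> O[at_right 0](\<lambda>\<epsilon>. 1 / \<epsilon>\<^sup>2 * ln (1 / \<epsilon>))"
  proof (rule bigoI[of _ "a * (b + c)"])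
    show "\<forall>\<^sub>F \<epsilon> in at_right 0. norm (real (alpha_grad_evals (T \<epsilon>) (K \<epsilon>)))
            \<le> a * (b + c) * norm (1 / \<epsilon>\<^sup>2 * ln (1 / \<epsilon>))"
      using ev
    proof eventually_elim
      case (elim \<epsilon>)
      note \<epsilon> = small[OF elim]
      have "b \<le> b * ln (1 / \<epsilon>)" using \<epsilon> assms(2) mult_left_mono[of 1 "ln (1 / \<epsilon>)" b] by simp
      then have "real (K \<epsilon>) \<le> (b + c) * ln (1 / \<epsilon>)" using K[of \<epsilon>] \<epsilon> by (simp add: distrib_right)
      then have "real (T \<epsilon>) * real (K \<epsilon>) \<le> (a / \<epsilon>\<^sup>2) * ((b + c) * ln (1 / \<epsilon>))"
        using T[of \<epsilon>] \<epsilon> assms(1) by (intro mult_mono) auto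
      also have "\<dots> = a * (b + c) * norm (1 / \<epsilon>\<^sup>2 * ln (1 / \<epsilon>))"
        using \<epsilon> by (simp add: abs_mult)
      finally show ?case by (simp add: alpha_grad_evals_def)
    qed
  qed
  have "(\<lambda>\<epsilon>. 1 / \<epsilon>\<^sup>2) \<in> O[at_right 0](\<lambda>\<epsilon>::real. 1 / \<epsilon>\<^sup>2 * ln (1 / \<epsilon>))"
  proof (rule bigoI[of _ 1])
    show "\<forall>\<^sub>F \<epsilon> in at_right 0. norm (1 / \<epsilon>\<^sup>2) \<le> 1 * norm (1 / \<epsilon>\<^sup>2 * ln (1 / \<epsilon> :: real))"
      using ev
    proof eventually_elim
      case (elim \<epsilon>)
      show ?case using small[OF elim] mult_left_mono[of 1 "ln (1 / \<epsilon>)" "1 / \<epsilon>\<^sup>2"] by (simp add: abs_mult)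
    qed
  qed
  with 1 have "(\<lambda>\<epsilon>. real (theta_grad_evals (T \<epsilon>))) \<in> O[at_right 0](\<lambda>\<epsilon>. 1 / \<epsilon>\<^sup>2 * ln (1 / \<epsilon>))"
    by (rule landau_o.big_trans)
  with 2 show "(\<lambda>\<epsilon>. cost * real (theta_grad_evals (T \<epsilon>)) + cost * real (alpha_grad_evals (T \<epsilon>) (K \<epsilon>)))
        \<in> O[at_right 0](\<lambda>\<epsilon>. 1 / \<epsilon>\<^sup>2 * ln (1 / \<epsilon>))"
    by (intro sum_in_bigo) (cases "cost = 0"; simp)+
qed

section \<open>Convergence and complexity of multi-step gradient descent ascent\<close>

theorem corollary3p5:
  fixes \<Theta> :: "(real ^ 'm) set" and c :: "real ^ 'm" and R :: real
    and f :: "real ^ 'm \<Rightarrow> real ^ 'n \<Rightarrow> real"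
    and f\<theta> :: "real ^ 'm \<Rightarrow> real ^ 'n \<Rightarrow> real ^ 'm"
    and f\<alpha> :: "real ^ 'm \<Rightarrow> real ^ 'n \<Rightarrow> real ^ 'n"
    and L11 L22 L12 \<mu> L :: real
    and \<theta>\<^sub>0 :: "real ^ 'm" and \<alpha>\<^sub>0 :: "real ^ 'n"
  assumes "\<Theta> \<noteq> {}" and "convex \<Theta>" and "compact \<Theta>" and "\<Theta> \<subseteq> cball c R"
    and "C1_with_partial_gradients_on f f\<theta> f\<alpha> (\<Theta> \<times> UNIV)"
    and "\<And>\<theta>1 \<theta>2 \<alpha>. \<theta>1 \<in> \<Theta> \<Longrightarrow> \<theta>2 \<in> \<Theta> \<Longrightarrow>
           norm (f\<theta> \<theta>1 \<alpha> - f\<theta> \<theta>2 \<alpha>) \<le> L11 * norm (\<theta>1 - \<theta>2)"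
    and "\<And>\<theta> \<alpha>1 \<alpha>2. \<theta> \<in> \<Theta> \<Longrightarrow>
           norm (f\<alpha> \<theta> \<alpha>1 - f\<alpha> \<theta> \<alpha>2) \<le> L22 * norm (\<alpha>1 - \<alpha>2)"
    and "\<And>\<theta>1 \<theta>2 \<alpha>. \<theta>1 \<in> \<Theta> \<Longrightarrow> \<theta>2 \<in> \<Theta> \<Longrightarrow>
           norm (f\<alpha> \<theta>1 \<alpha> - f\<alpha> \<theta>2 \<alpha>) \<le> L12 * norm (\<theta>1 - \<theta>2)"
    and "\<And>\<theta> \<alpha>1 \<alpha>2. \<theta> \<in> \<Theta> \<Longrightarrow>
           norm (f\<theta> \<theta> \<alpha>1 - f\<theta> \<theta> \<alpha>2) \<le> L12 * norm (\<alpha>1 - \<alpha>2)"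
    and "\<mu> > 0" and "\<And>\<theta>. \<theta> \<in> \<Theta> \<Longrightarrow> PL \<mu> (\<lambda>\<alpha>. - f \<theta> \<alpha>)"
    and "L > 0" and "smoothness_constant_on L (max_value f UNIV) \<Theta>"
    and "\<theta>\<^sub>0 \<in> \<Theta>"
  shows "\<exists>T K :: real \<Rightarrow> nat.
     (\<forall>\<epsilon>. 0 < \<epsilon> \<and> \<epsilon> < 1 \<longrightarrow>
        (\<exists>p \<in> set (gda_returned f\<theta> f\<alpha> \<Theta> (1 / L22) (1 / L) (T \<epsilon>) (K \<epsilon>) \<theta>\<^sub>0 \<alpha>\<^sub>0).
           first_order_Nash f\<theta> f\<alpha> \<Theta> UNIV \<epsilon> p)) \<and>
     (\<lambda>\<epsilon>. real (theta_grad_evals (T \<epsilon>))) \<in> O[at_right 0](\<lambda>\<epsilon>. 1 / \<epsilon>\<^sup>2) \<and>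
     (\<lambda>\<epsilon>. real (alpha_grad_evals (T \<epsilon>) (K \<epsilon>))) \<in> O[at_right 0](\<lambda>\<epsilon>. 1 / \<epsilon>\<^sup>2 * ln (1 / \<epsilon>)) \<and>
     (\<forall>cost > 0. (\<lambda>\<epsilon>. cost * real (theta_grad_evals (T \<epsilon>)) + cost * real (alpha_grad_evals (T \<epsilon>) (K \<epsilon>)))
        \<in> O[at_right 0](\<lambda>\<epsilon>. 1 / \<epsilon>\<^sup>2 * ln (1 / \<epsilon>)))"
proof -
  define g where "g = max_value f UNIV"
  note conv = assms(2) and comp = assms(3) and ball = assms(4) and C1 = assms(5)
  note lip22 = assms(7) and \<mu>0 = assms(10) and PL = assms(11) and L0 = assms(12) and \<theta>\<^sub>0 = assms(14)
  have closed: "closed \<Theta>" using comp by (rule compact_imp_closed)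
  have joint: "((\<lambda>(\<theta>, \<alpha>). f \<theta> \<alpha>) has_derivative (\<lambda>u. (f\<theta> \<theta> \<alpha>, f\<alpha> \<theta> \<alpha>) \<bullet> u)) (at (\<theta>, \<alpha>) within \<Theta> \<times> UNIV)"
    if "\<theta> \<in> \<Theta>" for \<theta> \<alpha>
    using C1 that unfolding C1_with_partial_gradients_on_def gradient_field_on_def by fastforce
  \<comment> \<open>Restricting the joint derivative to the slice over a fixed
    \<open>\<theta>\<close> gives a derivative on the whole space.\<close>
  have grad\<alpha>: "gradient_field_on (f \<theta>) (f\<alpha> \<theta>) UNIV" if "\<theta> \<in> \<Theta>" for \<theta>
    unfolding gradient_field_on_def
  proof
    fix \<alpha> :: "real ^ 'n"
    have "((\<lambda>\<alpha>. (\<theta>, \<alpha>)) has_derivative (\<lambda>u. (0, u))) (at \<alpha>)"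
      by (auto intro!: derivative_eq_intros)
    moreover have "((\<lambda>(\<theta>, \<alpha>). f \<theta> \<alpha>) has_derivative (\<lambda>u. (f\<theta> \<theta> \<alpha>, f\<alpha> \<theta> \<alpha>) \<bullet> u)) (at (\<theta>, \<alpha>) within range (\<lambda>\<alpha>. (\<theta>, \<alpha>)))"
      by (rule has_derivative_subset[OF joint[OF that]]) (use that in auto)
    ultimately show "(f \<theta> has_derivative (\<lambda>u. f\<alpha> \<theta> \<alpha> \<bullet> u)) (at \<alpha>)"
      using has_derivative_in_compose[of "\<lambda>\<alpha>. (\<theta>, \<alpha>)" "\<lambda>u. (0, u)" \<alpha> UNIV "\<lambda>(\<theta>, \<alpha>). f \<theta> \<alpha>"] by fastforce
  qed
  have max: "f \<theta> \<alpha> \<le> g \<theta>" and pl: "\<mu> * (g \<theta> - f \<theta> \<alpha>) \<le> 1 / 2 * (norm (f\<alpha> \<theta> \<alpha>))\<^sup>2" if "\<theta> \<in> \<Theta>" for \<theta> \<alpha>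
    using PL_minus_max_valueD[of \<mu> f \<theta> "f\<alpha> \<theta>", OF PL[OF that] grad\<alpha>[OF that]] by (simp_all add: g_def)
  \<comment> \<open>The Lipschitz bound between 0 and a unit vector decides the sign. If
    \<open>L22 = 0\<close>, then \<open>1 / L22\<close> is 0 and the inner loop stands still, but
    then every point is already a maximizer.\<close>
  have "L22 \<ge> 0"
  proof -
    have "0 \<le> L22 * norm (axis undefined 1 - 0 :: real ^ 'n)"
      using lip22[OF \<theta>\<^sub>0, of "axis undefined 1" 0] norm_ge_zero by (rule order_trans[rotated])
    then show ?thesis by simp
  qed
  have gb: "(norm (f\<alpha> \<theta> \<alpha>))\<^sup>2 \<le> 2 * L22 * (g \<theta> - f \<theta> \<alpha>)" if "\<theta> \<in> \<Theta>" for \<theta> \<alpha>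
    using gradient_norm_bound[of "f \<theta>" "f\<alpha> \<theta>" L22 "g \<theta>"] grad\<alpha> \<open>L22 \<ge> 0\<close> lip22 max that by blast
  obtain \<rho> C where \<rho>: "0 < \<rho>" "\<rho> < 1" and C: "C > 0"
    and inner: "\<And>\<theta> \<alpha> k. \<theta> \<in> \<Theta> \<Longrightarrow> g \<theta> - f \<theta> (ascent f\<alpha> (1 / L22) \<theta> \<alpha> k) \<le> \<rho> ^ k * (g \<theta> - f \<theta> \<alpha>)"
    and eb: "\<And>\<theta> \<alpha>. \<theta> \<in> \<Theta> \<Longrightarrow> \<exists>\<alpha>'. f \<theta> \<alpha>' = g \<theta> \<and> norm (\<alpha>' - \<alpha>) \<le> C * norm (f\<alpha> \<theta> \<alpha>)"
    using PL_ascent_constants[of L22 \<mu> \<Theta> f f\<alpha> g] \<open>L22 \<ge> 0\<close> \<mu>0 grad\<alpha> lip22 pl max by blast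
  define l where "l = \<bar>L12\<bar>"
  have l: "l \<ge> 0" by (simp add: l_def)
  have le_l: "L12 * r \<le> l * r" if "r \<ge> 0" for r
    unfolding l_def using that by (intro mult_right_mono) auto
  have lip\<alpha>: "norm (f\<alpha> \<theta>1 \<alpha> - f\<alpha> \<theta>2 \<alpha>) \<le> l * norm (\<theta>1 - \<theta>2)" if "\<theta>1 \<in> \<Theta>" "\<theta>2 \<in> \<Theta>" for \<theta>1 \<theta>2 \<alpha>
    using assms(8)[OF that, of \<alpha>] le_l[OF norm_ge_zero] by (rule order_trans)
  have lip\<theta>: "norm (f\<theta> \<theta> \<alpha>1 - f\<theta> \<theta> \<alpha>2) \<le> l * norm (\<alpha>1 - \<alpha>2)" if "\<theta> \<in> \<Theta>" for \<theta> \<alpha>1 \<alpha>2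
    using assms(9)[OF that, of \<alpha>1 \<alpha>2] le_l[OF norm_ge_zero] by (rule order_trans)

  \<comment> \<open>The gradient of the value function and its approximation\<close>
  have danskin: "(g has_derivative (\<lambda>u. f\<theta> \<theta> \<alpha> \<bullet> u)) (at \<theta> within \<Theta>)"
    if \<theta>: "\<theta> \<in> \<Theta>" and \<alpha>: "f \<theta> \<alpha> = g \<theta>" for \<theta> \<alpha>
  proof (rule has_derivative_max_value[where f = f and \<alpha> = \<alpha> and C = "C * l"])
    show "f \<theta> \<alpha> = g \<theta>" by (rule \<alpha>)
    have crit: "f\<alpha> \<theta> \<alpha> = 0" using gb[OF \<theta>, of \<alpha>] \<alpha> by simp
    then show "((\<lambda>(\<theta>, \<alpha>). f \<theta> \<alpha>) has_derivative (\<lambda>u. (f\<theta> \<theta> \<alpha>, 0) \<bullet> u)) (at (\<theta>, \<alpha>) within \<Theta> \<times> UNIV)"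
      using joint[OF \<theta>, of \<alpha>] by simp
    show "0 \<le> C * l" using C l by simp
    fix \<theta>' assume \<theta>': "\<theta>' \<in> \<Theta>"
    \<comment> \<open>The error bound is applied at the new \<open>\<theta>'\<close> but at the old
      maximizer \<open>\<alpha>\<close>, whose gradient has size at most
      \<open>l * norm (\<theta>' - \<theta>)\<close> because it vanishes at
      \<open>\<theta>\<close>.\<close>
    obtain \<alpha>' where "f \<theta>' \<alpha>' = g \<theta>'" "norm (\<alpha>' - \<alpha>) \<le> C * norm (f\<alpha> \<theta>' \<alpha>)" using eb[OF \<theta>'] by blast
    moreover have "C * norm (f\<alpha> \<theta>' \<alpha>) \<le> C * (l * norm (\<theta>' - \<theta>))"
      using lip\<alpha>[OF \<theta>' \<theta>, of \<alpha>] crit C by simp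
    ultimately show "\<exists>\<alpha>'. f \<theta>' \<alpha>' = g \<theta>' \<and> norm (\<alpha>' - \<alpha>) \<le> C * l * norm (\<theta>' - \<theta>)"
      by (intro exI[of _ \<alpha>']) simp
  qed
  obtain G where G: "gradient_field_on g G \<Theta>"
    and lipG: "\<And>x y. x \<in> \<Theta> \<Longrightarrow> y \<in> \<Theta> \<Longrightarrow> norm (G x - G y) \<le> L * norm (x - y)"
    using assms(13) unfolding smoothness_constant_on_def g_def by blast

  \<comment> \<open>The comparison goes through a nearby exact maximizer \<open>\<alpha>'\<close>,
    at which \<open>f\<theta>\<close> and \<open>G\<close> agree in feasible directions.\<close>
  have err: "\<bar>(f\<theta> \<theta> \<alpha> - G \<theta>) \<bullet> (u - \<theta>)\<bar> \<le> l * C * norm (f\<alpha> \<theta> \<alpha>) * norm (u - \<theta>)"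
    if \<theta>: "\<theta> \<in> \<Theta>" and u: "u \<in> \<Theta>" for \<theta> \<alpha> u
  proof -
    obtain \<alpha>' where \<alpha>': "f \<theta> \<alpha>' = g \<theta>" "norm (\<alpha>' - \<alpha>) \<le> C * norm (f\<alpha> \<theta> \<alpha>)" using eb[OF \<theta>] by blast
    have "f\<theta> \<theta> \<alpha>' \<bullet> (u - \<theta>) = G \<theta> \<bullet> (u - \<theta>)"
      by (rule feasible_derivative_unique[OF conv \<theta> u danskin[OF \<theta> \<alpha>'(1)]])
         (use G \<theta> in \<open>simp add: gradient_field_on_def\<close>)
    then have "(f\<theta> \<theta> \<alpha> - G \<theta>) \<bullet> (u - \<theta>) = (f\<theta> \<theta> \<alpha> - f\<theta> \<theta> \<alpha>') \<bullet> (u - \<theta>)"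
      by (simp add: inner_diff_left)
    also have "\<bar>\<dots>\<bar> \<le> norm (f\<theta> \<theta> \<alpha> - f\<theta> \<theta> \<alpha>') * norm (u - \<theta>)"
      by (rule Cauchy_Schwarz_ineq2)
    also have "norm (f\<theta> \<theta> \<alpha> - f\<theta> \<theta> \<alpha>') \<le> l * norm (\<alpha>' - \<alpha>)"
      using lip\<theta>[OF \<theta>, of \<alpha> \<alpha>'] by (simp add: norm_minus_commute)
    also have "\<dots> \<le> l * (C * norm (f\<alpha> \<theta> \<alpha>))" using \<alpha>'(2) l by (rule mult_left_mono)
    finally show ?thesis by (simp add: mult_right_mono mult.assoc)
  qed
  have diam: "norm (x - y) \<le> 2 * \<bar>R\<bar>" if "x \<in> \<Theta>" "y \<in> \<Theta>" for x y
  proof -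
    have "dist x c \<le> R" "dist y c \<le> R" using ball that by (auto simp: dist_commute)
    then show ?thesis using dist_triangle2[of x y c] unfolding dist_norm[symmetric] by linarith
  qed
  obtain lo where lo: "\<And>\<theta>. \<theta> \<in> \<Theta> \<Longrightarrow> lo \<le> g \<theta>"
  proof -
    have "continuous_on \<Theta> g"
      using G has_derivative_continuous unfolding gradient_field_on_def continuous_on_eq_continuous_within by blast
    from continuous_attains_inf[OF comp assms(1) this] that show ?thesis by blast
  qed

  \<comment> \<open>Choice of the constants and iteration numbers\<close>
  define M where "M = norm (G \<theta>\<^sub>0) + L * (2 * \<bar>R\<bar>)"
  have M: "norm (G \<theta>) \<le> M" if "\<theta> \<in> \<Theta>" for \<theta>
  proof -
    have "norm (G \<theta>) \<le> norm (G \<theta>\<^sub>0) + norm (G \<theta> - G \<theta>\<^sub>0)" by (rule norm_triangle_sub)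
    also have "norm (G \<theta> - G \<theta>\<^sub>0) \<le> L * norm (\<theta> - \<theta>\<^sub>0)" by (rule lipG[OF that \<theta>\<^sub>0])
    also have "\<dots> \<le> L * (2 * \<bar>R\<bar>)" using diam[OF that \<theta>\<^sub>0] L0 by simp
    finally show ?thesis by (simp add: M_def)
  qed
  \<comment> \<open>\<open>B\<close> dominates the factor
    \<open>norm (G \<theta>) + \<kappa> * \<epsilon> + L\<close> of the stationarity estimate, so a
    step of length at most \<open>\<epsilon> / B\<close> certifies a gap of at most
    \<open>\<epsilon>\<close>.\<close>
  define B where "B = M + 1 + L"
  have B: "B > 0" using M[OF \<theta>\<^sub>0] norm_ge_zero[of "G \<theta>\<^sub>0"] L0 unfolding B_def by linarith
  \<comment> \<open>The gradient error will be \<open>\<kappa> * \<epsilon>\<close>; the bound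
    \<open>L / (4 * B)\<close> makes its effect on descent at most a quarter of the decrease from a
    step of length \<open>\<epsilon> / B\<close>.\<close>
  define \<kappa> where "\<kappa> = min 1 (L / (4 * B))"
  have \<kappa>: "\<kappa> > 0" "\<kappa> \<le> 1" "\<kappa> \<le> L / (4 * B)" using B L0 by (auto simp: \<kappa>_def)
  \<comment> \<open>The inner loop aims at gradient size \<open>\<gamma> * \<epsilon>\<close>: the
    second entry gives the error \<open>\<kappa> * \<epsilon>\<close>, the first gives stationarity
    in \<open>\<alpha>\<close>. Adding 1 to \<open>l\<close> avoids division by zero.\<close>
  define \<gamma> where "\<gamma> = min 1 (\<kappa> / (C * (l + 1)))"
  have \<gamma>: "\<gamma> > 0" "\<gamma> \<le> 1" using \<kappa> C l by (auto simp: \<gamma>_def)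
  have \<gamma>\<kappa>: "l * C * \<gamma> \<le> \<kappa>"
  proof -
    have "l * C * \<gamma> \<le> (C * (l + 1)) * (\<kappa> / (C * (l + 1)))"
    proof (rule mult_mono)
      show "l * C \<le> C * (l + 1)" using C by (simp add: algebra_simps)
      show "\<gamma> \<le> \<kappa> / (C * (l + 1))" by (simp add: \<gamma>_def)
    qed (use C l \<gamma> in auto)
    also have "\<dots> = \<kappa>" using C l by simp
    finally show ?thesis .
  qed
  \<comment> \<open>A bound for the gap at the start of every inner loop: the first entry serves
    \<open>t = 0\<close>, the second the later warm starts, via PL and the diameter of
    \<open>\<Theta>\<close>.\<close>
  define \<Delta> where "\<Delta> = max (g \<theta>\<^sub>0 - f \<theta>\<^sub>0 \<alpha>\<^sub>0) ((1 + l * (2 * \<bar>R\<bar>))\<^sup>2 / (2 * \<mu>))"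
  have \<Delta>: "\<Delta> \<ge> 0" using max[OF \<theta>\<^sub>0, of \<alpha>\<^sub>0] by (simp add: \<Delta>_def)
  define A where "A = 2 * L22 * \<Delta> + 1"
  have A: "A > 0" unfolding A_def using \<Delta> \<open>L22 \<ge> 0\<close> by (intro add_nonneg_pos) auto
  \<comment> \<open>The total possible decrease of \<open>g\<close> divided by the decrease
    \<open>L * \<epsilon>\<^sup>2 / (8 * B\<^sup>2)\<close> per long step; rounding down and adding
    1 makes the inequality strict.\<close>
  define T where "T \<epsilon> = nat \<lfloor>8 * B\<^sup>2 * (g \<theta>\<^sub>0 - lo) / (L * \<epsilon>\<^sup>2)\<rfloor> + 1" for \<epsilon>
  define K where "K \<epsilon> = nat \<lceil>ln (A / (\<gamma> * \<epsilon>)\<^sup>2) / ln (1 / \<rho>)\<rceil>" for \<epsilon>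
  have \<rho>ln: "ln (1 / \<rho>) > 0" using \<rho> by simp

  \<comment> \<open>An equilibrium among the computed pairs\<close>
  have nash: "\<exists>p \<in> set (gda_returned f\<theta> f\<alpha> \<Theta> (1 / L22) (1 / L) (T \<epsilon>) (K \<epsilon>) \<theta>\<^sub>0 \<alpha>\<^sub>0).
           first_order_Nash f\<theta> f\<alpha> \<Theta> UNIV \<epsilon> p" if \<epsilon>: "0 < \<epsilon>" "\<epsilon> < 1" for \<epsilon>
  proof -
    define it where "it = gda f\<theta> f\<alpha> \<Theta> (1 / L22) (1 / L) (K \<epsilon>) \<theta>\<^sub>0 \<alpha>\<^sub>0"
    define x where "x t = fst (it t)" for t
    define y where "y t = ascent f\<alpha> (1 / L22) (x t) (snd (it t)) (K \<epsilon>)" for t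
    have it0: "x 0 = \<theta>\<^sub>0" "snd (it 0) = \<alpha>\<^sub>0" by (simp_all add: x_def it_def)
    have xS: "x (Suc t) = closest_point \<Theta> (x t - (1 / L) *\<^sub>R f\<theta> (x t) (y t))"
      and yS: "snd (it (Suc t)) = y t" for t
      by (simp_all add: x_def y_def it_def Let_def split: prod.split)
    have x_mem: "x t \<in> \<Theta>" for t
      by (cases t) (auto simp: it0 \<theta>\<^sub>0 xS intro!: closest_point_in_set closed assms(1))
    have K: "\<rho> ^ K \<epsilon> * A \<le> (\<gamma> * \<epsilon>)\<^sup>2"
      by (rule geometric_iterations_suffice[OF \<rho> A]) (use \<gamma> \<epsilon> in \<open>simp_all add: K_def real_nat_ceiling_ge\<close>)
    \<comment> \<open>Stated conditionally, because the induction for \<open>warm\<close> needs it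
      at step \<open>t\<close> to control the gap at step \<open>Suc t\<close>.\<close>
    have small: "norm (f\<alpha> (x t) (y t)) \<le> \<gamma> * \<epsilon>" if "g (x t) - f (x t) (snd (it t)) \<le> \<Delta>" for t
    proof (rule power2_le_imp_le)
      have "(norm (f\<alpha> (x t) (y t)))\<^sup>2 \<le> 2 * L22 * (g (x t) - f (x t) (y t))"
        by (rule gb[OF x_mem])
      also have "\<dots> \<le> 2 * L22 * (\<rho> ^ K \<epsilon> * \<Delta>)"
      proof (rule mult_left_mono)
        have "g (x t) - f (x t) (y t) \<le> \<rho> ^ K \<epsilon> * (g (x t) - f (x t) (snd (it t)))"
          unfolding y_def by (rule inner[OF x_mem])
        also have "\<dots> \<le> \<rho> ^ K \<epsilon> * \<Delta>" using that \<rho> by (intro mult_left_mono) auto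
        finally show "g (x t) - f (x t) (y t) \<le> \<rho> ^ K \<epsilon> * \<Delta>" .
      qed (use \<open>L22 \<ge> 0\<close> in simp)
      also have "\<dots> \<le> \<rho> ^ K \<epsilon> * A" using \<rho> by (simp add: A_def algebra_simps)
      also note K
      finally show "(norm (f\<alpha> (x t) (y t)))\<^sup>2 \<le> (\<gamma> * \<epsilon>)\<^sup>2" .
    qed (use \<gamma> \<epsilon> in simp)
    have warm: "g (x t) - f (x t) (snd (it t)) \<le> \<Delta>" for t
    proof (induction t)
      case (Suc t)
      have "norm (f\<alpha> (x (Suc t)) (y t)) \<le> norm (f\<alpha> (x t) (y t)) + norm (f\<alpha> (x (Suc t)) (y t) - f\<alpha> (x t) (y t))"
        by (rule norm_triangle_sub)
      also have "norm (f\<alpha> (x (Suc t)) (y t) - f\<alpha> (x t) (y t)) \<le> l * norm (x (Suc t) - x t)"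
        by (rule lip\<alpha>[OF x_mem x_mem])
      also have "\<dots> \<le> l * (2 * \<bar>R\<bar>)" by (rule mult_left_mono[OF diam[OF x_mem x_mem] l])
      also have "norm (f\<alpha> (x t) (y t)) \<le> \<gamma> * \<epsilon>" by (rule small[OF Suc])
      also have "\<gamma> * \<epsilon> \<le> 1" using \<gamma> \<epsilon> by (intro mult_le_one) auto
      finally have "(norm (f\<alpha> (x (Suc t)) (y t)))\<^sup>2 \<le> (1 + l * (2 * \<bar>R\<bar>))\<^sup>2"
        by (intro power_mono) auto
      with pl[OF x_mem[of "Suc t"], of "y t"]
      have "g (x (Suc t)) - f (x (Suc t)) (y t) \<le> (1 + l * (2 * \<bar>R\<bar>))\<^sup>2 / (2 * \<mu>)"
        using \<mu>0 by (simp add: pos_le_divide_eq mult.commute)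
      then show ?case by (simp add: yS \<Delta>_def)
    qed (simp add: it0 \<Delta>_def)
    note sm = small[OF warm]
    have e: "\<bar>(f\<theta> (x t) (y t) - G (x t)) \<bullet> (u - x t)\<bar> \<le> \<kappa> * \<epsilon> * norm (u - x t)" if "u \<in> \<Theta>" for t u
    proof -
      have "l * C * norm (f\<alpha> (x t) (y t)) \<le> l * C * (\<gamma> * \<epsilon>)"
        using sm l C by (intro mult_left_mono) auto
      also have "\<dots> \<le> \<kappa> * \<epsilon>" using mult_right_mono[OF \<gamma>\<kappa>, of \<epsilon>] \<epsilon> by (simp add: mult.assoc)
      finally have "l * C * norm (f\<alpha> (x t) (y t)) * norm (u - x t) \<le> \<kappa> * \<epsilon> * norm (u - x t)"
        by (rule mult_right_mono) simp
      with err[OF x_mem that] show ?thesis by (rule order_trans)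
    qed
    have descent: "g (x (Suc t)) \<le> g (x t) - L / 4 * (norm (x (Suc t) - x t))\<^sup>2 + (\<kappa> * \<epsilon>)\<^sup>2 / L" for t
      unfolding xS by (rule inexact_projected_gradient_step(1)[OF conv closed x_mem L0 G lipG e])
    have stationarity: "- (norm (G (x t)) + \<kappa> * \<epsilon> + L) * norm (x (Suc t) - x t) \<le> f\<theta> (x t) (y t) \<bullet> (u - x t)"
      if "u \<in> \<Theta>" "norm (u - x t) \<le> 1" for t u
      unfolding xS by (rule inexact_projected_gradient_step(2)[OF conv closed x_mem L0 G lipG e]) (use that in auto)
    \<comment> \<open>The short step may end at \<open>x (T \<epsilon>)\<close>, outside the
      returned list; only its starting point \<open>x t\<close> has to be listed.\<close>
    obtain t where t: "t < T \<epsilon>" "norm (x (Suc t) - x t) \<le> \<epsilon> / B"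
    proof -
      have "\<exists>t<T \<epsilon>. norm (x (Suc t) - x t) \<le> \<epsilon> / B"
      proof (rule exists_small_step[where v = "\<lambda>t. g (x t)"])
        show "0 \<le> L / 4" "0 \<le> \<epsilon> / B" using L0 \<epsilon> B by auto
        show "g (x (Suc t)) \<le> g (x t) - L / 4 * (norm (x (Suc t) - x t))\<^sup>2 + (\<kappa> * \<epsilon>)\<^sup>2 / L" for t
          by (rule descent)
        show "lo \<le> g (x t)" for t by (rule lo[OF x_mem])
        have "(\<kappa> * \<epsilon>)\<^sup>2 / L \<le> (L / (4 * B) * \<epsilon>)\<^sup>2 / L"
          using \<kappa> \<epsilon> L0 by (intro divide_right_mono power_mono mult_right_mono) auto
        also have "\<dots> = L * \<epsilon>\<^sup>2 / (16 * B\<^sup>2)"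
          using L0 B by (simp add: power2_eq_square)
        also have "\<dots> \<le> L * \<epsilon>\<^sup>2 / (8 * B\<^sup>2)"
          using L0 B \<epsilon> by (intro divide_left_mono) auto
        finally have decr: "L * \<epsilon>\<^sup>2 / (8 * B\<^sup>2) \<le> L / 4 * (\<epsilon> / B)\<^sup>2 - (\<kappa> * \<epsilon>)\<^sup>2 / L"
          by (simp add: power_divide)
        have "8 * B\<^sup>2 * (g \<theta>\<^sub>0 - lo) / (L * \<epsilon>\<^sup>2) < real (T \<epsilon>)"
          unfolding T_def by linarith
        then have "g \<theta>\<^sub>0 - lo < real (T \<epsilon>) * (L * \<epsilon>\<^sup>2 / (8 * B\<^sup>2))"
          using L0 B \<epsilon> by (simp add: field_simps)
        also have "\<dots> \<le> real (T \<epsilon>) * (L / 4 * (\<epsilon> / B)\<^sup>2 - (\<kappa> * \<epsilon>)\<^sup>2 / L)"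
          by (rule mult_left_mono[OF decr]) simp
        finally show "g (x 0) - lo < real (T \<epsilon>) * (L / 4 * (\<epsilon> / B)\<^sup>2 - (\<kappa> * \<epsilon>)\<^sup>2 / L)"
          by (simp add: it0)
      qed
      then show ?thesis using that by blast
    qed
    have "first_order_Nash f\<theta> f\<alpha> \<Theta> UNIV \<epsilon> (x t, y t)"
    proof (rule first_order_NashI[OF x_mem])
      have "\<gamma> * \<epsilon> \<le> \<epsilon>" using \<gamma> \<epsilon> by simp
      then show "norm (f\<alpha> (x t) (y t)) \<le> \<epsilon>" using sm[of t] by linarith
      fix u assume u: "u \<in> \<Theta>" "norm (u - x t) \<le> 1"
      have "\<kappa> * \<epsilon> \<le> 1" using \<kappa> \<epsilon> by (intro mult_le_one) auto
      then have "(norm (G (x t)) + \<kappa> * \<epsilon> + L) * norm (x (Suc t) - x t) \<le> B * (\<epsilon> / B)"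
        using M[OF x_mem, of t] t(2) B by (intro mult_mono) (auto simp: B_def)
      also have "\<dots> = \<epsilon>" using B by simp
      finally show "- \<epsilon> \<le> f\<theta> (x t) (y t) \<bullet> (u - x t)"
        using stationarity[OF u] unfolding mult_minus_left by linarith
    qed
    moreover have "(x t, y t) \<in> set (gda_returned f\<theta> f\<alpha> \<Theta> (1 / L22) (1 / L) (T \<epsilon>) (K \<epsilon>) \<theta>\<^sub>0 \<alpha>\<^sub>0)"
      using t(1) by (auto simp: gda_returned_def x_def y_def it_def split: prod.split intro!: image_eqI[of _ _ t])
    ultimately show ?thesis by blast
  qed

  \<comment> \<open>Bounds on the iteration numbers\<close>
  have T_bound: "real (T \<epsilon>) \<le> (8 * B\<^sup>2 * (g \<theta>\<^sub>0 - lo) / L + 1) / \<epsilon>\<^sup>2" if \<epsilon>: "0 < \<epsilon>" "\<epsilon> < 1" for \<epsilon>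
  proof -
    have "0 \<le> 8 * B\<^sup>2 * (g \<theta>\<^sub>0 - lo) / (L * \<epsilon>\<^sup>2)" using lo[OF \<theta>\<^sub>0] L0 by simp
    then have "real (T \<epsilon>) \<le> 8 * B\<^sup>2 * (g \<theta>\<^sub>0 - lo) / (L * \<epsilon>\<^sup>2) + 1" unfolding T_def by linarith
    also have "1 \<le> 1 / \<epsilon>\<^sup>2" using \<epsilon> power_le_one[of \<epsilon> 2] by simp
    finally show ?thesis by (simp add: add_divide_distrib)
  qed
  have K_bound: "real (K \<epsilon>) \<le> (\<bar>ln (A / \<gamma>\<^sup>2)\<bar> / ln (1 / \<rho>) + 1) + 2 / ln (1 / \<rho>) * ln (1 / \<epsilon>)"
    if \<epsilon>: "0 < \<epsilon>" "\<epsilon> < 1" for \<epsilon>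
  proof -
    have "ln (1 / \<epsilon>) \<ge> 0" using \<epsilon> by simp
    have "ln (A / (\<gamma> * \<epsilon>)\<^sup>2) = ln (A / \<gamma>\<^sup>2) + 2 * ln (1 / \<epsilon>)"
      using A \<gamma> \<epsilon> by (simp add: ln_div ln_mult ln_realpow)
    \<comment> \<open>The absolute value keeps the bound nonnegative, since \<open>nat\<close> cuts
      off negative values of the ceiling in \<open>K\<close>.\<close>
    also have "\<dots> \<le> \<bar>ln (A / \<gamma>\<^sup>2)\<bar> + 2 * ln (1 / \<epsilon>)" by simp
    finally have "ln (A / (\<gamma> * \<epsilon>)\<^sup>2) / ln (1 / \<rho>) \<le> (\<bar>ln (A / \<gamma>\<^sup>2)\<bar> + 2 * ln (1 / \<epsilon>)) / ln (1 / \<rho>)"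
      using \<rho>ln by (intro divide_right_mono) auto
    moreover have "0 \<le> (\<bar>ln (A / \<gamma>\<^sup>2)\<bar> + 2 * ln (1 / \<epsilon>)) / ln (1 / \<rho>)"
      using \<rho>ln \<open>ln (1 / \<epsilon>) \<ge> 0\<close> by (intro divide_nonneg_pos) auto
    ultimately have "real (K \<epsilon>) \<le> (\<bar>ln (A / \<gamma>\<^sup>2)\<bar> + 2 * ln (1 / \<epsilon>)) / ln (1 / \<rho>) + 1"
      unfolding K_def by linarith
    then show ?thesis by (simp add: add_divide_distrib)
  qed
  have nonneg: "0 \<le> 8 * B\<^sup>2 * (g \<theta>\<^sub>0 - lo) / L + 1" "0 \<le> \<bar>ln (A / \<gamma>\<^sup>2)\<bar> / ln (1 / \<rho>) + 1" "0 \<le> 2 / ln (1 / \<rho>)"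
    using lo[OF \<theta>\<^sub>0] L0 \<rho>ln by auto
  note complexity = oracle_complexity[OF nonneg T_bound K_bound]
  show ?thesis
    by (intro exI[of _ T] exI[of _ K] conjI allI impI complexity) (use nash in auto)
qed

end
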